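(* Let $n,k,l,r$ be any integers with $n\geq k+l$ and $l\geq r\geq 1$, let $c$ be a positive constant, and let $\mathscr{A}\subseteq \binom{[n]}{k}$ and $\mathscr{B}\subseteq \binom{[n]}{l}$. If $\mathscr{A}$ and $\mathscr{B}$ are cross-intersecting and $\binom{n-r}{l-r}\leq|\mathscr{B}|\leq \binom{n-1}{l-1}$, then $$|\mathscr{A}|+c|\mathscr{B}|\leq \max\left\{\binom{n}{k}-\binom{n-r}{k}+c\binom{n-r}{l-r},\ \binom{n-1}{k-1}+c\binom{n-1}{l-1}\right\},$$ and the upper bound is attained if and only if one of the following holds: (i) $\binom{n}{k}-\binom{n-r}{k}+c\binom{n-r}{l-r}\geq\binom{n-1}{k-1}+c\binom{n-1}{l-1}$, $n>k+l$, $\mathscr{A}=\{A\in \binom{[n]}{k}:[r]\cap A\neq \emptyset\}$ and $\mathscr{B}=\{B\in\binom{[n]}{l}:[r]\subseteq B\}$; (ii) $\binom{n}{k}-\binom{n-r}{k}+c\binom{n-r}{l-r}\leq\binom{n-1}{k-1}+c\binom{n-1}{l-1}$, $n>k+l$, $\mathscr{A}=\{A\in \binom{[n]}{k}:1\in A\}$ and $\mathscr{B}=\{B\in \binom{[n]}{l}:1\in B\}$; (iii) $n=k+l$, $c<1$, $\mathscr{B}\subset\binom{[n]}{l}$ with $|\mathscr{B}|=\binom{n-r}{l-r}$, and $\mathscr{A}=\binom{[n]}{k}\setminus\overline{\mathscr{B}}$; (iv) $n=k+l$, $c=1$, $\mathscr{B}\subset\binom{[n]}{l}$ with $\binom{n-r}{l-r}\leq|\mathscr{B}|\leq\binom{n-1}{l-1}$,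 and $\mathscr{A}=\binom{[n]}{k}\setminus\overline{\mathscr{B}}$; (v) $n=k+l$, $c>1$, $\mathscr{B}\subset\binom{[n]}{l}$ with $|\mathscr{B}|=\binom{n-1}{l-1}$, and $\mathscr{A}=\binom{[n]}{k}\setminus\overline{\mathscr{B}}$.
   Context: For a natural number $m$, $[m]=\{1,2,\dots,m\}$, and for an integer $i>0$, $\binom{[n]}{i}$ denotes the collection of all $i$-element subsets of $[n]$. Two families $\mathscr{A},\mathscr{B}$ of subsets of $[n]$ are called cross-intersecting if $A\cap B\neq\emptyset$ for all $A\in\mathscr{A}$ and $B\in\mathscr{B}$. For a family $\mathscr{B}$ of subsets of $[n]$, $\overline{\mathscr{B}}=\{[n]\setminus B: B\in\mathscr{B}\}$.
   Formalization: In (i) and (ii) the pair (A, B) is required to equal the listed pair only up to one permutation of [n]; read literally the "only if" fails, e.g. n=3, k=l=r=1, A=B={{2}} attains the bound. *)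

theory Defs
  imports Complex_Main "HOL-Library.Ramsey" "HOL-Combinatorics.Permutations"
begin

definition cross_intersecting :: "'a set set \<Rightarrow> 'a set set \<Rightarrow> bool" where
  "cross_intersecting \<A> \<B> \<longleftrightarrow> (\<forall>A\<in>\<A>. \<forall>B\<in>\<B>. A \<inter> B \<noteq> {})"

definition compl_family :: "nat \<Rightarrow> nat set set \<Rightarrow> nat set set" where
  "compl_family n \<B> = {{1..n} - B | B. B \<in> \<B>}"

text \<open>
  The extremal configurations are determined only up to relabelling of the ground set
  (the star at 2 does as well as the star at 1). One and the same
  permutation relabels both families of the pair.
\<close>

definition pair_isomorphic ::
  "nat \<Rightarrow> nat set set \<times> nat set set \<Rightarrow> nat set set \<times> nat set set \<Rightarrow> bool" where
  "pair_isomorphic n P Q \<longleftrightarrow>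
     (\<exists>\<pi>. \<pi> permutes {1..n} \<and>
        fst P = (\<lambda>A. \<pi> ` A) ` fst Q \<and> snd P = (\<lambda>B. \<pi> ` B) ` snd Q)"

end

theory Submission
  imports Defs
begin

text \<open>
  Let \<open>s = n - l\<close> and let \<open>F\<close> consist of the complements of the members of \<open>\<B>\<close>, so that \<open>\<A>\<close> avoids the
  \<open>k\<close>-shadow of \<open>F\<close>. If \<open>n = k + l\<close>, this shadow is \<open>F\<close> itself and everything is linear in \<open>card \<B>\<close>.
  Otherwise write \<open>card \<B> = x gchoose s\<close> with \<open>x\<close> real and \<open>n - r \<le> x \<le> n - 1\<close>. By Lovasz's form of
  the Kruskal-Katona theorem the shadow has at least \<open>x gchoose k\<close> members, with equality only if
  \<open>F\<close> consists of all \<open>s\<close>-subsets of an \<open>x\<close>-element set. Since \<open>x gchoose k\<close> is a strictly concave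
  function of \<open>x gchoose s\<close>, the resulting bound on \<open>card \<A> + c * card \<B>\<close> is maximal only at the two
  end points. The shadow bound is proved by Keevash's double counting, which also yields the case
  of equality.
\<close>

section \<open>Real binomial coefficients\<close>

lemma gbinomial_Suc_factor:
  "(x::real) gchoose Suc r = (x gchoose r) * (x - real r) / real (Suc r)"
  using gbinomial_absorb_comp[of x r] gbinomial_absorption[of r "x-1"]
  using gbinomial_mult_1[of x r]
  by (simp add: field_simps)

lemma gbinomial_pos:
  assumes "x \<ge> real r"
  shows "(x::real) gchoose r > 0"
  using assms
proof (induction r)
  case (Suc r)
  then show ?case by (simp add: gbinomial_Suc_factor)
qed simp

text \<open>From \<open>real r - 1\<close> on, every factor of the falling factorial is nonnegative
  and increasing, so the product grows strictly.\<close>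

lemma gbinomial_less:
  assumes "x < y" "x \<ge> real r - 1" "r \<ge> 1"
  shows "(x::real) gchoose r < y gchoose r"
  using assms(3,1,2)
proof (induction r rule: nat_induct_at_least[of 1])
  case base
  then show ?case by simp
next
  case (Suc r)
  have "(x gchoose r) * (x - real r) < (y gchoose r) * (y - real r)"
    using Suc gbinomial_pos[of r x] by (intro mult_strict_mono) auto
  then show ?case by (simp add: gbinomial_Suc_factor divide_strict_right_mono)
qed

lemma gbinomial_mono:
  assumes "x \<le> y" "x \<ge> real r"
  shows "(x::real) gchoose r \<le> y gchoose r"
  using assms gbinomial_less[of x y r] by (cases "r = 0"; cases "x = y") auto

text \<open>Intermediate values: the polynomial is 1 at \<open>r\<close> and at least
  \<open>m ^ r\<close> at \<open>r * m\<close>. Positive cardinalities thus become real binomial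
  coefficients.\<close>

lemma gbinomial_surj:
  assumes "m \<ge> 1" "r \<ge> 1"
  obtains x where "x \<ge> real r" "x gchoose r = (m::real)"
proof -
  have cont: "continuous_on {real r..real r * m} (\<lambda>x. x gchoose r)"
    unfolding gbinomial_prod_rev by (intro continuous_intros) auto
  have "m \<le> m ^ r"
    using assms by (intro self_le_power) auto
  also have "\<dots> = (real r * m / real r) ^ r"
    using assms by simp
  also have "\<dots> \<le> (real r * m) gchoose r"
    using assms by (intro gbinomial_ge_n_over_k_pow_k) auto
  finally have up: "m \<le> (real r * m) gchoose r" .
  have low: "real r gchoose r \<le> m"
    using assms by (simp flip: binomial_gbinomial)
  have "real r \<le> real r * m"
    using assms by simp
  from IVT'[OF low up this cont] show ?thesis
    using that by auto
qed

text \<open>Strict convexity of \<open>1 / (x gchoose r)\<close>, scaled by \<open>b - a\<close>. It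
  passes to \<open>Suc r\<close> because a product of positive decreasing convex functions is
  convex, here of \<open>1 / (x gchoose r)\<close> and \<open>1 / (x - real r)\<close>.\<close>

lemma inverse_gbinomial_convex:
  fixes a x b :: real
  assumes "r \<ge> 1" "real r \<le> a" "a < x" "x < b"
  shows "(b - a) / (x gchoose r) < (b - x) / (a gchoose r) + (x - a) / (b gchoose r)"
  using assms
proof (induction r rule: nat_induct_at_least[of 1])
  case base
  have "(b - x) / a + (x - a) / b - (b - a) / x = (b - a) * (b - x) * (x - a) / (a * b * x)"
    using base by (simp add: field_simps) (simp add: algebra_simps)?
  moreover have "(b - a) * (b - x) * (x - a) / (a * b * x) > 0"
    using base by simp
  ultimately show ?case by simp
next
  case (Suc r)
  define w where "w z = inverse (z gchoose r)" for z :: real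
  define v where "v z = inverse (z - real r)" for z :: real
  have w: "(b - a) * w x < (b - x) * w a + (x - a) * w b"
    using Suc by (simp add: w_def divide_inverse)
  have v: "(b - a) * v x \<le> (b - x) * v a + (x - a) * v b"
  proof -
    have "(b - x) * v a + (x - a) * v b - (b - a) * v x = (b - a) * (b - x) * (x - a) * (v a * v b * v x)"
      using Suc by (simp add: v_def divide_simps) algebra
    moreover have "(b - a) * (b - x) * (x - a) * (v a * v b * v x) \<ge> 0"
      using Suc by (simp add: v_def)
    ultimately show ?thesis by linarith
  qed
  have mono: "w b \<le> w a" "v b \<le> v a"
    using Suc gbinomial_mono[of a b r] gbinomial_pos[of r a]
    by (auto simp: w_def v_def intro!: le_imp_inverse_le)
  have pos: "w x > 0" "v x > 0"
    using Suc gbinomial_pos[of r x] by (auto simp: w_def v_def)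
  have "(b - a) * ((b - a) * (w x * v x)) = ((b - a) * w x) * ((b - a) * v x)"
    by simp
  also have "\<dots> < ((b - x) * w a + (x - a) * w b) * ((b - x) * v a + (x - a) * v b)"
    using w v pos Suc.prems by (intro mult_less_le_imp_less) auto
  \<comment> \<open>Up to scaling, the product of the two linear interpolants falls short of the
    interpolant of the product by a term that is nonnegative because \<open>w\<close> and
    \<open>v\<close> decrease together.\<close>
  also have "\<dots> = (b - a) * ((b - x) * (w a * v a) + (x - a) * (w b * v b))
      - (b - x) * (x - a) * ((w a - w b) * (v a - v b))"
    by algebra
  also have "\<dots> \<le> (b - a) * ((b - x) * (w a * v a) + (x - a) * (w b * v b))"
    using mono Suc.prems by simp
  finally have "(b - a) * (w x * v x) < (b - x) * (w a * v a) + (x - a) * (w b * v b)"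
    using Suc.prems by simp
  then have "real (Suc r) * ((b - a) * (w x * v x))
      < real (Suc r) * ((b - x) * (w a * v a) + (x - a) * (w b * v b))"
    by (simp only: mult_less_cancel_left_pos of_nat_0_less_iff zero_less_Suc)
  moreover have "p / (z gchoose Suc r) = real (Suc r) * (p * (w z * v z))" for p z
    by (simp add: gbinomial_Suc_factor w_def v_def divide_inverse del: of_nat_Suc)
  ultimately show ?case
    by (simp only: distrib_left)
qed

text \<open>
  Consecutive secant slopes of \<open>x gchoose s\<close> against \<open>x gchoose k\<close> increase. For \<open>s = k + 1\<close> this
  is the strict convexity of \<open>1 / (x gchoose k)\<close>, and slopes multiply along \<open>k < k + 1 < \<dots> < s\<close>.
\<close>

lemma gbinomial_secant_slope_less:
  fixes a x b :: real
  assumes "k \<ge> 1" "k < s" "real s \<le> a" "a < x" "x < b"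
  shows "((x gchoose s) - (a gchoose s)) * ((b gchoose k) - (x gchoose k))
    < ((b gchoose s) - (x gchoose s)) * ((x gchoose k) - (a gchoose k))"
proof -
  have step_Suc: "((x gchoose Suc r) - (a gchoose Suc r)) * ((b gchoose r) - (x gchoose r))
    < ((b gchoose Suc r) - (x gchoose Suc r)) * ((x gchoose r) - (a gchoose r))"
    if r: "r \<ge> 1" "real r \<le> a" for r
  proof -
    define p q t where "p = a gchoose r" and "q = x gchoose r" and "t = b gchoose r"
    have pos: "p > 0" "q > 0" "t > 0"
      using r assms by (auto simp: p_def q_def t_def intro!: gbinomial_pos)
    have "(b - a) / q < (b - x) / p + (x - a) / t"
      unfolding p_def q_def t_def using r assms by (intro inverse_gbinomial_convex) auto
    then have "(b - a) * p * t < ((b - x) * t + (x - a) * p) * q"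
      using pos by (simp add: field_simps)
    \<comment> \<open>By \<open>gbinomial_Suc_factor\<close>, \<open>p * (a - r)\<close> and its
      analogues are the binomials of level \<open>Suc r\<close> times \<open>real (Suc r)\<close>;
      expanding both sides gives back the convexity inequality.\<close>
    then have "(q * (x - r) - p * (a - r)) * (t - q) < (t * (b - r) - q * (x - r)) * (q - p)"
      by (simp add: algebra_simps)
    then show ?thesis
      unfolding gbinomial_Suc_factor p_def [symmetric] q_def [symmetric] t_def [symmetric]
      by (simp add: divide_strict_right_mono flip: diff_divide_distrib)
  qed
  have pos: "y gchoose r < z gchoose r" if "y < z" "r \<ge> k" "real r \<le> a" "a \<le> y" for r y z
    using that assms by (intro gbinomial_less) auto
  from \<open>k < s\<close> have "Suc k \<le> s" by simp
  then show ?thesis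
    using \<open>real s \<le> a\<close>
  proof (induction s rule: dec_induct)
    case base
    then show ?case using step_Suc assms by simp
  next
    case (step r)
    define L R where "L j = (x gchoose j) - (a gchoose j)" and "R j = (b gchoose j) - (x gchoose j)" for j
    have pos: "L r > 0" "R r > 0" "L k > 0" "R k > 0" "L (Suc r) > 0" "R (Suc r) > 0"
      using pos[of a x] pos[of x b] step assms by (auto simp: L_def R_def)
    have 1: "L (Suc r) * R r < R (Suc r) * L r"
      unfolding L_def R_def using step assms by (intro step_Suc) auto
    have 2: "L r * R k < R r * L k"
      unfolding L_def R_def using step by simp
    \<comment> \<open>Multiply the slope comparison for \<open>r\<close> and \<open>Suc r\<close> by
      the one for \<open>k\<close> and \<open>r\<close>; the common factor \<open>L r * R r\<close>
      then cancels.\<close>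
    have "(L (Suc r) * R r) * (L r * R k) < (R (Suc r) * L r) * (R r * L k)"
      using pos by (intro mult_strict_mono[OF 1 2]) (auto intro: less_imp_le)
    then have "(L (Suc r) * R k) * (L r * R r) < (R (Suc r) * L k) * (L r * R r)"
      by (simp only: mult_ac)
    then have "L (Suc r) * R k < R (Suc r) * L k"
      using pos by (simp only: mult_less_cancel_right_pos mult_pos_pos)
    then show ?case
      by (simp add: L_def R_def)
  qed
qed

text \<open>Were neither end point strictly better, the secant slope of \<open>x gchoose s\<close>
  against \<open>x gchoose k\<close> would be at least \<open>1 / c\<close> left of \<open>x\<close>
  and at most \<open>1 / c\<close> right of it, but slopes increase.\<close>

lemma gbinomial_combination_less_max:
  fixes a x b c :: real
  assumes "k \<ge> 1" "k < s" "real s \<le> a" "a < x" "x < b" "c > 0"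
  shows "c * (x gchoose s) - (x gchoose k)
    < max (c * (a gchoose s) - (a gchoose k)) (c * (b gchoose s) - (b gchoose k))"
proof (rule ccontr)
  define L R where "L j = (x gchoose j) - (a gchoose j)" and "R j = (b gchoose j) - (x gchoose j)" for j
  assume "\<not> ?thesis"
  then have L: "L k \<le> c * L s" and R: "c * R s \<le> R k"
    by (auto simp: L_def R_def algebra_simps)
  have pos: "L k > 0" "R s > 0"
    using assms gbinomial_less[of a x k] gbinomial_less[of x b s] by (auto simp: L_def R_def)
  have "c * (R s * L k) \<le> R k * L k"
    using R pos by (simp add: mult.assoc [symmetric])
  also have "\<dots> \<le> R k * (c * L s)"
    using L R pos assms by (intro mult_left_mono) (auto intro: order_trans[of _ "c * R s"])
  finally have "c * (R s * L k) \<le> c * (L s * R k)"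
    by (simp add: mult_ac)
  then have "R s * L k \<le> L s * R k"
    using \<open>c > 0\<close> by simp
  with gbinomial_secant_slope_less[OF assms(1-5)] show False
    by (simp add: L_def R_def)
qed

section \<open>Cliques in uniform families\<close>

definition link :: "'a \<Rightarrow> 'a set set \<Rightarrow> 'a set set" where
  "link v G = (\<lambda>S. S - {v}) ` {S \<in> G. v \<in> S}"

lemma card_link: "card (link v G) = card {S \<in> G. v \<in> S}"
  unfolding link_def by (intro card_image inj_onI) blast

lemma sum_card_link:
  assumes "finite V" "finite G" "\<And>S. S \<in> G \<Longrightarrow> S \<subseteq> V \<and> card S = r"
  shows "(\<Sum>v\<in>V. card (link v G)) = r * card G"
  unfolding card_link
proof (rule sum_multicount)
  show "\<forall>S\<in>G. card {v \<in> V. v \<in> S} = r"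
    using assms(3) by (metis Collect_mem_eq Collect_conj_eq inf.absorb2)
qed (use assms in auto)

text \<open>
  For a vertex \<open>v\<close> of degree \<open>d\<close>, the members of \<open>F\<close> through \<open>v\<close> are bounded both by the members of
  \<open>G\<close> avoiding \<open>v\<close> and, inductively, in terms of the link. Whichever of the two is the better bound,
  it is at most \<open>(x / r - 1) * d\<close>; summing over \<open>v\<close> gives the claim.
\<close>

lemma clique_bound:
  fixes F G :: "'a set set" and x :: real
  assumes "r \<ge> 1" "finite G" "\<And>S. S \<in> G \<Longrightarrow> finite S \<and> card S = r"
    and "\<And>S. S \<in> F \<Longrightarrow> finite S \<and> card S = Suc r"
    and "\<And>S v. S \<in> F \<Longrightarrow> v \<in> S \<Longrightarrow> S - {v} \<in> G"
    and "x \<ge> real r" "real (card G) = x gchoose r"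
  shows "real (card F) \<le> x gchoose Suc r \<and>
    (real (card F) = x gchoose Suc r \<longrightarrow> (\<exists>X. finite X \<and> real (card X) = x \<and> G = nsets X r))"
  using assms
proof (induction r arbitrary: F G x rule: nat_induct_at_least[of 1])
  case base
  \<comment> \<open>\<open>G\<close> consists of singletons, so it is all of
    \<open>nsets X 1\<close>, and \<open>F\<close> is a graph on \<open>X\<close>.\<close>
  define X where "X = \<Union>G"
  have G: "G = nsets X 1"
  proof -
    have "\<exists>v. S = {v}" if "S \<in> G" for S
      using base(2) that by (auto simp: card_1_singleton_iff)
    then show ?thesis
      unfolding X_def One_nat_def nsets_one by fastforce
  qed
  have "finite X"
    using base unfolding X_def by auto
  have x: "real (card X) = x"
    using base(6) unfolding G by simp
  have "F \<subseteq> nsets X 2"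
  proof
    fix S assume S: "S \<in> F"
    have "v \<in> X" if "v \<in> S" for v
    proof -
      obtain w where "w \<in> S" "w \<noteq> v"
        using base(3)[OF S] \<open>v \<in> S\<close>
        by (metis Suc_1 card_1_singleton_iff card_2_iff' One_nat_def)
      then show ?thesis
        using base(4)[OF S, of w] \<open>v \<in> S\<close> unfolding X_def by blast
    qed
    then show "S \<in> nsets X 2"
      using base(3)[OF S] by (auto simp: nsets_def)
  qed
  then have "card F \<le> card X choose 2"
    using \<open>finite X\<close> by (metis card_mono card_nsets finite_imp_finite_nsets)
  then have "real (card F) \<le> real (card X choose 2)"
    by simp
  then show ?case
    using x G \<open>finite X\<close> by (auto simp: binomial_gbinomial numeral_2_eq_2)
next
  case (Suc r)
  note G = Suc.prems(1,2) and F = Suc.prems(3,4)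
  define V where "V = \<Union>G"
  have "finite V"
    using G by (auto simp: V_def)
  \<comment> \<open>Each \<open>v\<close> of \<open>S\<close> survives in \<open>S - {w}\<close> for
    some other \<open>w\<close>, and that set is in \<open>G\<close>.\<close>
  have FV: "S \<subseteq> V" if S: "S \<in> F" for S
  proof
    fix v assume "v \<in> S"
    have "card (S - {v}) \<noteq> 0"
      using F(1)[OF S] \<open>v \<in> S\<close> by simp
    then obtain w where "w \<in> S" "w \<noteq> v"
      by (metis card.empty Diff_iff all_not_in_conv insertI1)
    then show "v \<in> V"
      using F(2)[OF S, of w] \<open>v \<in> S\<close> unfolding V_def by blast
  qed
  have "finite F"
    using FV \<open>finite V\<close> by (meson PowI finite_Pow_iff finite_subset subsetI)
  \<comment> \<open>Chosen so that \<open>q * real (Suc r) * (x gchoose Suc r)\<close> equals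
    \<open>real (Suc (Suc r)) * (x gchoose Suc (Suc r))\<close>, which makes the degree bounds add
    up exactly.\<close>
  define q where "q = x / real (Suc r) - 1"
  have x: "x \<ge> real (Suc r)" "real (card G) = x gchoose Suc r"
    using Suc.prems by auto
  have xr: "(x gchoose Suc r) = x / real (Suc r) * ((x - 1) gchoose r)"
    using gbinomial_absorption'[of "Suc r" x] by simp
  have local_bound: "real (card (link v F)) \<le> q * card (link v G) \<and>
      (real (card (link v F)) = q * card (link v G) \<longrightarrow> real (card (link v G)) = (x - 1) gchoose r)"
    if "v \<in> V" for v
  proof -
    define d where "d = real (card (link v G))"
    have "link v G \<noteq> {}"
      using \<open>v \<in> V\<close> by (auto simp: V_def link_def)
    moreover have fin: "finite (link v G)"
      using G by (auto simp: link_def)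
    ultimately have "d \<ge> 1"
      unfolding d_def by (simp add: Suc_leI card_gt_0_iff)
    then obtain y where y: "y \<ge> real r" "y gchoose r = d"
      using gbinomial_surj[of d r] Suc.hyps by auto
    have "real (card (link v F)) \<le> y gchoose Suc r"
    proof (rule Suc.IH[THEN conjunct1])
      show "finite S \<and> card S = r" if "S \<in> link v G" for S
        using that G by (auto simp: link_def)
      show "finite S \<and> card S = Suc r" if "S \<in> link v F" for S
        using that F by (auto simp: link_def)
      show "S - {w} \<in> link v G" if S: "S \<in> link v F" "w \<in> S" for S w
      proof -
        obtain T where T: "T \<in> F" "v \<in> T" "S = T - {v}"
          using S(1) by (auto simp: link_def)
        then have "T - {w} \<in> G" "v \<in> T - {w}" "S - {w} = T - {w} - {v}"
          using F(2)[of T w] S(2) by auto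
        then show ?thesis by (auto simp: link_def)
      qed
    qed (use fin y d_def in auto)
    then have bound1: "real (card (link v F)) \<le> d * (y - real r) / real (Suc r)"
      by (simp add: gbinomial_Suc_factor y)
    \<comment> \<open>Deleting \<open>v\<close> from a member of \<open>F\<close> leaves a member of
      \<open>G\<close> that avoids \<open>v\<close>.\<close>
    have "card (link v F) \<le> card (G - {S \<in> G. v \<in> S})"
      using F G by (intro card_mono) (auto simp: link_def)
    also have "real \<dots> = card G - d"
      using G by (simp add: card_Diff_subset card_link d_def of_nat_diff card_mono)
    finally have bound2: "real (card (link v F)) \<le> x / real (Suc r) * ((x - 1) gchoose r) - d"
      using x xr by simp
    show ?thesis
    \<comment> \<open>The two bounds meet at \<open>d = (x - 1) gchoose r\<close>. From there on
      \<open>bound2\<close> suffices, with equality only at the meeting point; below it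
      \<open>bound1\<close> is strictly less than \<open>q * d\<close>.\<close>
    proof (cases "d \<ge> (x - 1) gchoose r")
      case True
      then have "x / real (Suc r) * ((x - 1) gchoose r) \<le> x / real (Suc r) * d"
        using x by (intro mult_left_mono) auto
      moreover have "q * d = x / real (Suc r) * d - d"
        by (simp add: q_def algebra_simps)
      moreover have "x / real (Suc r) > 0"
        using x by simp
      ultimately show ?thesis
        using bound2 unfolding d_def [symmetric] by (auto simp: d_def)
    next
      case False
      then have "y < x - 1"
        using gbinomial_mono[of "x - 1" y r] x y by fastforce
      then have "d * (y - real r) / real (Suc r) < d * (x - 1 - real r) / real (Suc r)"
        using \<open>d \<ge> 1\<close> by (simp add: divide_strict_right_mono)
      also have "\<dots> = q * d"
        by (simp add: q_def field_simps)
      finally show ?thesis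
        using bound1 unfolding d_def by auto
    qed
  qed
  have sumF: "(\<Sum>v\<in>V. real (card (link v F))) = real (Suc (Suc r)) * card F"
    using sum_card_link[of V F "Suc (Suc r)"] \<open>finite V\<close> \<open>finite F\<close> FV F
    by (simp only: of_nat_sum [symmetric] of_nat_mult [symmetric])
  have sumG: "(\<Sum>v\<in>V. real (card (link v G))) = real (Suc r) * card G"
    using sum_card_link[of V G "Suc r"] \<open>finite V\<close> G Union_upper[of _ G, folded V_def]
    by (simp only: of_nat_sum [symmetric] of_nat_mult [symmetric])
  have qG: "q * (\<Sum>v\<in>V. real (card (link v G))) = real (Suc (Suc r)) * (x gchoose Suc (Suc r))"
    unfolding sumG x(2) gbinomial_Suc_factor[of x "Suc r"] q_def
    by (simp add: field_simps del: of_nat_Suc)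
  have "(\<Sum>v\<in>V. real (card (link v F))) \<le> (\<Sum>v\<in>V. q * real (card (link v G)))"
    using local_bound by (intro sum_mono) auto
  then have "real (Suc (Suc r)) * card F \<le> real (Suc (Suc r)) * (x gchoose Suc (Suc r))"
    using sumF qG by (simp add: sum_distrib_left)
  then have le: "real (card F) \<le> x gchoose Suc (Suc r)"
    by (simp only: mult_le_cancel_left_pos of_nat_0_less_iff zero_less_Suc)
  \<comment> \<open>Equality of the sums forces equality at every vertex, so all degrees are
    \<open>(x - 1) gchoose r\<close>. Counting incidences gives \<open>card V = x\<close>, and then
    \<open>G\<close> is as large as \<open>nsets V (Suc r)\<close>.\<close>
  have "\<exists>X. finite X \<and> real (card X) = x \<and> G = nsets X (Suc r)"
    if eq: "real (card F) = x gchoose Suc (Suc r)"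
  proof (intro exI conjI)
    have "(\<Sum>v\<in>V. real (card (link v F))) = (\<Sum>v\<in>V. q * real (card (link v G)))"
      using sumF qG eq by (simp add: sum_distrib_left)
    then have "real (card (link v F)) = q * real (card (link v G))" if "v \<in> V" for v
      using sum_mono_inv[of "\<lambda>v. real (card (link v F))" V "\<lambda>v. q * real (card (link v G))" v]
        local_bound that \<open>finite V\<close> by auto
    then have "real (card (link v G)) = (x - 1) gchoose r" if "v \<in> V" for v
      using local_bound that by auto
    then have "card V * ((x - 1) gchoose r) = real (Suc r) * card G"
      using sumG by simp
    also have "\<dots> = x * ((x - 1) gchoose r)"
      unfolding x(2) xr by simp
    finally show "real (card V) = x"
      using gbinomial_pos[of r "x - 1"] x by simp
    then have "real (card G) = real (card (nsets V (Suc r)))"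
      using x by (simp add: binomial_gbinomial)
    moreover have "G \<subseteq> nsets V (Suc r)"
      using G by (auto simp: nsets_def V_def)
    ultimately show "G = nsets V (Suc r)"
      using \<open>finite V\<close> by (intro card_subset_eq) (auto simp: finite_imp_finite_nsets)
  qed (use \<open>finite V\<close> in auto)
  with le show ?case by blast
qed

section \<open>Shadows\<close>

definition shadow :: "nat \<Rightarrow> 'a set set \<Rightarrow> 'a set set" where
  "shadow k F = (\<Union>S\<in>F. nsets S k)"

lemma shadow_self:
  assumes "\<And>S. S \<in> F \<Longrightarrow> finite S \<and> card S = k"
  shows "shadow k F = F"
proof -
  have "nsets S k = {S}" if "S \<in> F" for S
    using assms[OF that] by (auto simp: nsets_def dest: card_subset_eq)
  then show ?thesis
    by (simp add: shadow_def)
qed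

text \<open>A \<open>k\<close>-set inside \<open>S\<close> extends to an \<open>s\<close>-set inside
  \<open>S\<close>; shadows can be taken level by level.\<close>

lemma shadow_shadow:
  assumes "k \<le> s" "\<And>S. S \<in> F \<Longrightarrow> finite S \<and> s \<le> card S"
  shows "shadow k (shadow s F) = shadow k F"
proof
  show "shadow k F \<subseteq> shadow k (shadow s F)"
  proof
    fix T assume "T \<in> shadow k F"
    then obtain S where S: "S \<in> F" "T \<subseteq> S" "card T = k" "finite T"
      by (auto simp: shadow_def nsets_def)
    then obtain U where "T \<subseteq> U" "U \<subseteq> S" "card U = s"
      using assms by (meson exists_subset_between)
    then have "U \<in> shadow s F" "T \<in> nsets U k"
      using S assms by (auto simp: shadow_def nsets_def intro: finite_subset)
    then show "T \<in> shadow k (shadow s F)"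
      unfolding shadow_def[of k "shadow s F"] by blast
  qed
qed (auto simp: shadow_def nsets_def)

lemma finite_shadow:
  assumes "finite F" "\<And>S. S \<in> F \<Longrightarrow> finite S"
  shows "finite (shadow k F)"
  using assms by (auto simp: shadow_def finite_imp_finite_nsets)

lemma shadow_nsets_subset: "shadow k (nsets X s) \<subseteq> nsets X k"
  by (auto simp: shadow_def nsets_def)

lemma shadow_nsets:
  assumes "k \<le> s" "s \<le> card X" "finite X"
  shows "shadow k (nsets X s) = nsets X k"
proof
  show "nsets X k \<subseteq> shadow k (nsets X s)"
  proof
    fix T assume T: "T \<in> nsets X k"
    then obtain U where "T \<subseteq> U" "U \<subseteq> X" "card U = s"
      using exists_subset_between[of T s X] assms by (auto simp: nsets_def)
    then show "T \<in> shadow k (nsets X s)"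
      using T assms by (auto simp: shadow_def nsets_def intro: finite_subset)
  qed
qed (rule shadow_nsets_subset)

text \<open>Descend one level at a time: members of \<open>F\<close> are cliques over the next
  shadow \<open>G\<close>, so \<open>clique_bound\<close> keeps \<open>G\<close> large, and
  induction handles \<open>G\<close>. For \<open>k = s\<close> the shadow is \<open>F\<close> itself
  and equality says nothing about \<open>F\<close>, hence the proviso \<open>k < s\<close>.\<close>

lemma shadow_lower_bound:
  fixes F :: "'a set set" and x :: real
  assumes "1 \<le> k" "k \<le> s" "finite F" "\<And>S. S \<in> F \<Longrightarrow> finite S \<and> card S = s"
    and "x \<ge> real s" "real (card F) = x gchoose s"
  shows "x gchoose k \<le> real (card (shadow k F)) \<and>
    (k < s \<and> real (card (shadow k F)) = x gchoose k \<longrightarrow>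
      (\<exists>X. finite X \<and> real (card X) = x \<and> F = nsets X s))"
  using assms(2-)
proof (induction s arbitrary: F x rule: dec_induct)
  case base
  then show ?case using shadow_self[of F k] by simp
next
  case (step s)
  note F = step.prems(1,2)
  define G where "G = shadow s F"
  have G: "finite G" "\<And>S. S \<in> G \<Longrightarrow> finite S \<and> card S = s"
    using F finite_shadow[of F s] by (auto simp: G_def shadow_def nsets_def)
  have kG: "shadow k F = shadow k G"
    unfolding G_def using F step.hyps by (intro shadow_shadow [symmetric]) auto
  have FG: "S - {v} \<in> G" if "S \<in> F" "v \<in> S" for S v
    using F(2)[of S] that by (auto simp: G_def shadow_def nsets_def intro!: bexI[of _ S])
  have "card F > 0"
    using gbinomial_pos[of "Suc s" x] step.prems by simp
  then obtain S where "S \<in> F" by (auto simp: card_gt_0_iff)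
  moreover from this F(2) obtain v where "v \<in> S"
    by (metis card.empty equals0I nat.distinct(1))
  ultimately have "G \<noteq> {}" using FG by blast
  then have "real (card G) \<ge> 1"
    using G by (simp add: Suc_leI card_gt_0_iff)
  then obtain y where y: "y \<ge> real s" "y gchoose s = real (card G)"
    using gbinomial_surj assms(1) step.hyps by (metis le_trans)
  have cb: "real (card F) \<le> y gchoose Suc s \<and>
    (real (card F) = y gchoose Suc s \<longrightarrow> (\<exists>X. finite X \<and> real (card X) = y \<and> G = nsets X s))"
    by (rule clique_bound) (use assms(1) step.hyps G F FG y in auto)
  \<comment> \<open>\<open>y\<close> measures the shadow as \<open>x\<close> measures
    \<open>F\<close>; with \<open>y < x\<close>, \<open>F\<close> would exceed the clique
    bound.\<close>
  have xy: "x \<le> y"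
  proof (rule ccontr)
    assume "\<not> x \<le> y"
    then have "y gchoose Suc s < x gchoose Suc s"
      using y by (intro gbinomial_less) auto
    with cb step.prems show False by simp
  qed
  have ks: "real k \<le> real s" using step.hyps by simp
  have le: "x gchoose k \<le> y gchoose k"
    using xy step.prems ks by (intro gbinomial_mono) auto
  have IH: "y gchoose k \<le> real (card (shadow k G))"
    using step.IH[OF G y(1)] y by simp
  have "\<exists>X. finite X \<and> real (card X) = x \<and> F = nsets X (Suc s)"
    if eq: "real (card (shadow k F)) = x gchoose k"
  proof -
    \<comment> \<open>The chain \<open>x gchoose k \<le> y gchoose k \<le> card (shadow k F)\<close>
      is tight. With \<open>x = y\<close>, \<open>F\<close> attains the clique bound, so
      \<open>G\<close> is complete on some \<open>X\<close>.\<close>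
    have "x = y"
    proof (rule ccontr)
      assume "x \<noteq> y"
      then have "x gchoose k < y gchoose k"
        using xy step.prems ks assms(1) by (intro gbinomial_less) auto
      with IH kG eq show False by simp
    qed
    then obtain X where X: "finite X" "real (card X) = x" "G = nsets X s"
      using cb step.prems by auto
    have "S \<in> nsets X (Suc s)" if "S \<in> F" for S
    proof -
      have "v \<in> X" if "v \<in> S" for v
      proof -
        have "card (S - {v}) \<noteq> 0"
          using F(2)[OF \<open>S \<in> F\<close>] \<open>v \<in> S\<close> assms(1) step.hyps by simp
        then obtain w where "w \<in> S" "w \<noteq> v"
          by (metis card.empty Diff_iff all_not_in_conv insertI1)
        then show ?thesis
          using FG[OF \<open>S \<in> F\<close>, of w] \<open>v \<in> S\<close> X(3) by (auto simp: nsets_def)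
      qed
      then show ?thesis
        using F(2)[OF \<open>S \<in> F\<close>] by (auto simp: nsets_def)
    qed
    then have "F = nsets X (Suc s)"
      using X step.prems by (intro card_subset_eq finite_imp_finite_nsets)
        (auto simp: binomial_gbinomial simp flip: of_nat_eq_iff[where 'a = real])
    with X show ?thesis by blast
  qed
  with IH le kG show ?case by auto
qed

section \<open>Candidate extremal families, complements and relabelling\<close>

abbreviation (input) hitting :: "nat \<Rightarrow> nat \<Rightarrow> nat set \<Rightarrow> nat set set" where
  "hitting n k R \<equiv> {A \<in> nsets {1..n} k. R \<inter> A \<noteq> {}}"

text \<open>Paired with \<open>hitting n k R\<close>, this is cross-intersecting;
  \<open>R = {1..r}\<close> and \<open>R = {1..1}\<close> give the two extremal configurations for
  \<open>n > k + l\<close>.\<close>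

abbreviation (input) containing :: "nat \<Rightarrow> nat \<Rightarrow> nat set \<Rightarrow> nat set set" where
  "containing n l R \<equiv> {B \<in> nsets {1..n} l. R \<subseteq> B}"

lemma inj_on_compl: "inj_on (\<lambda>B. N - B) {B. B \<subseteq> N}"
  by (auto simp: inj_on_def)

lemma compl_family_image: "compl_family n \<B> = (\<lambda>B. {1..n} - B) ` \<B>"
  by (auto simp: compl_family_def)

lemma card_compl_family:
  assumes "\<B> \<subseteq> nsets {1..n} l"
  shows "card (compl_family n \<B>) = card \<B>"
  unfolding compl_family_image using assms
  by (intro card_image inj_on_subset[OF inj_on_compl]) (auto simp: nsets_def)

lemma compl_family_compl_family:
  assumes "\<B> \<subseteq> nsets {1..n} l"
  shows "compl_family n (compl_family n \<B>) = \<B>"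
proof -
  have "{1..n} - ({1..n} - B) = B" if "B \<in> \<B>" for B
    using that assms by (auto simp: nsets_def)
  then show ?thesis
    unfolding compl_family_image image_image by simp
qed

lemma compl_family_subset:
  assumes "\<B> \<subseteq> nsets {1..n} l"
  shows "compl_family n \<B> \<subseteq> nsets {1..n} (n - l)"
  using assms by (auto simp: compl_family_image nsets_def card_Diff_subset)

lemma hitting_eq: "hitting n k R = nsets {1..n} k - nsets ({1..n} - R) k"
  by (auto simp: nsets_def)

text \<open>Translates the complete family on \<open>{1..n} - R\<close>, the equality case for
  shadows, back into \<open>\<B>\<close>.\<close>

lemma compl_family_nsets:
  assumes "R \<subseteq> {1..n}" "l \<le> n"
  shows "compl_family n (nsets ({1..n} - R) (n - l)) = containing n l R"
proof (intro equalityI subsetI)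
  fix B assume "B \<in> compl_family n (nsets ({1..n} - R) (n - l))"
  then show "B \<in> containing n l R"
    using assms by (auto simp: compl_family_image nsets_def card_Diff_subset subset_iff)
next
  fix B assume B: "B \<in> containing n l R"
  then have "{1..n} - B \<in> nsets ({1..n} - R) (n - l)" "B = {1..n} - ({1..n} - B)"
    by (auto simp: nsets_def card_Diff_subset)
  then show "B \<in> compl_family n (nsets ({1..n} - R) (n - l))"
    unfolding compl_family_image by blast
qed

lemma card_hitting:
  assumes "R \<subseteq> {1..n}"
  shows "real (card (hitting n k R)) = real (n choose k) - real ((n - card R) choose k)"
proof -
  have "nsets ({1..n} - R) k \<subseteq> nsets {1..n} k"
    by (intro nsets_mono) auto
  then show ?thesis
    unfolding hitting_eq using assms finite_subset[OF assms] binomial_right_mono[of "n - card R" n k]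
    by (simp add: card_Diff_subset finite_imp_finite_nsets of_nat_diff)
qed

lemma choose_compl:
  assumes "r \<le> l" "l \<le> n"
  shows "(n - r) choose (n - l) = (n - r) choose (l - r)"
  using assms by (subst binomial_symmetric) auto

lemma card_containing:
  assumes "R \<subseteq> {1..n}" "card R \<le> l" "l \<le> n"
  shows "card (containing n l R) = (n - card R) choose (l - card R)"
proof -
  have sub: "nsets ({1..n} - R) (n - l) \<subseteq> nsets {1..n} (n - l)"
    by (intro nsets_mono) auto
  show ?thesis
    unfolding compl_family_nsets[OF assms(1,3), symmetric] card_compl_family[OF sub]
    using assms finite_subset[OF assms(1)] choose_compl[of "card R" l n]
    by (simp add: card_Diff_subset)
qed

lemma permutes_image_family:
  assumes "\<pi> permutes {1..n}" "R \<subseteq> {1..n}"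
  shows "hitting n k (\<pi> ` R) = (`) \<pi> ` hitting n k R"
    and "containing n l (\<pi> ` R) = (`) \<pi> ` containing n l R"
proof -
  have inj: "inj \<pi>"
    using assms(1) by (rule permutes_inj)
  have "bij_betw \<pi> {1..n} {1..n}"
    using assms(1) by (rule permutes_imp_bij)
  then have ns: "nsets {1..n} j = (`) \<pi> ` nsets {1..n} j" for j
    using bij_betw_nsets[of \<pi> "{1..n}" "{1..n}" j] by (simp add: bij_betw_def)
  show "hitting n k (\<pi> ` R) = (`) \<pi> ` hitting n k R"
    by (subst ns) (auto simp: image_iff inj_eq[OF inj] dest: injD[OF inj])
  show "containing n l (\<pi> ` R) = (`) \<pi> ` containing n l R"
    by (subst ns) (auto simp: inj_image_subset_iff[OF inj])
qed

text \<open>Glue a bijection from \<open>Q\<close> to \<open>R\<close> with one between their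
  complements in \<open>N\<close>, and fix all points outside \<open>N\<close>.\<close>

lemma permutes_exists_image:
  assumes "finite N" "Q \<subseteq> N" "R \<subseteq> N" "card Q = card R"
  obtains \<pi> where "\<pi> permutes N" "\<pi> ` Q = R"
proof -
  have "finite Q" "finite R"
    using assms finite_subset by auto
  then obtain f where f: "bij_betw f Q R"
    using assms finite_same_card_bij by blast
  have "card (N - Q) = card (N - R)"
    using assms \<open>finite Q\<close> \<open>finite R\<close> by (simp add: card_Diff_subset)
  then obtain g where g: "bij_betw g (N - Q) (N - R)"
    using assms finite_same_card_bij by blast
  define \<pi> where "\<pi> x = (if x \<in> Q then f x else if x \<in> N then g x else x)" for x
  have Q: "bij_betw \<pi> Q R"
    using f by (subst bij_betw_cong[of _ _ f]) (auto simp: \<pi>_def)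
  moreover have "bij_betw \<pi> (N - Q) (N - R)"
    using g by (subst bij_betw_cong[of _ _ g]) (auto simp: \<pi>_def)
  ultimately have "bij_betw \<pi> (Q \<union> (N - Q)) (R \<union> (N - R))"
    by (rule bij_betw_combine) auto
  then have "bij_betw \<pi> N N"
    using assms by (simp add: Un_absorb1)
  then have "\<pi> permutes N"
    using assms by (intro bij_imp_permutes) (auto simp: \<pi>_def)
  with Q that show ?thesis
    by (auto simp: bij_betw_def)
qed

lemma pair_isomorphic_hitting_containing:
  assumes "R \<subseteq> {1..n}" "card R = r"
  shows "pair_isomorphic n (hitting n k R, containing n l R)
    (hitting n k {1..r}, containing n l {1..r})"
proof -
  have "r \<le> n"
    using assms card_mono[of "{1..n}" R] by simp
  then obtain \<pi> where \<pi>: "\<pi> permutes {1..n}" "\<pi> ` {1..r} = R"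
    using permutes_exists_image[of "{1..n}" "{1..r}" R] assms by auto
  with \<open>r \<le> n\<close> permutes_image_family[of \<pi> n "{1..r}"] show ?thesis
    unfolding pair_isomorphic_def by (intro exI[of _ \<pi>]) auto
qed

lemma pair_isomorphic_card:
  assumes "pair_isomorphic n (\<A>, \<B>) (\<A>', \<B>')"
  shows "card \<A> = card \<A>'" "card \<B> = card \<B>'"
proof -
  obtain \<pi> where \<pi>: "\<pi> permutes {1..n}" "\<A> = (`) \<pi> ` \<A>'" "\<B> = (`) \<pi> ` \<B>'"
    using assms by (auto simp: pair_isomorphic_def)
  have "inj ((`) \<pi>)"
    using permutes_inj[OF \<pi>(1)] by (simp add: inj_image_eq_iff inj_def)
  then have "inj_on ((`) \<pi>) S" for S
    by (rule inj_on_subset) simp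
  then show "card \<A> = card \<A>'" "card \<B> = card \<B>'"
    unfolding \<pi> by (simp_all add: card_image)
qed

section \<open>Extremal pairs\<close>

text \<open>A \<open>k\<close>-set inside the complement of some \<open>B\<close> misses
  \<open>B\<close>.\<close>

lemma compl_family_disjoint_shadow:
  assumes "cross_intersecting \<A> \<B>" "\<A> \<subseteq> nsets {1..n} k"
  shows "\<A> \<inter> shadow k (compl_family n \<B>) = {}"
  using assms unfolding cross_intersecting_def compl_family_image shadow_def nsets_def
  by blast

text \<open>The value of the hitting and containing pair of a \<open>j\<close>-set;
  \<open>j = r\<close> and \<open>j = 1\<close> give the two terms of the maximum.\<close>

definition weight :: "nat \<Rightarrow> nat \<Rightarrow> nat \<Rightarrow> real \<Rightarrow> nat \<Rightarrow> real" where
  "weight n k l c j =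
     real (n choose k) - real ((n - j) choose k) + c * real ((n - j) choose (l - j))"

lemma weight_hitting_containing:
  assumes "R \<subseteq> {1..n}" "card R \<le> l" "l \<le> n"
  shows "real (card (hitting n k R)) + c * real (card (containing n l R)) = weight n k l c (card R)"
  unfolding weight_def card_hitting[OF assms(1)] card_containing[OF assms] ..

lemma weight_one:
  assumes "n \<ge> 1" "k \<ge> 1"
  shows "weight n k l c 1 = real ((n - 1) choose (k - 1)) + c * real ((n - 1) choose (l - 1))"
  using assms choose_reduce_nat[of n k] by (simp add: weight_def)

text \<open>The witness \<open>j\<close> records which end point, \<open>n - r\<close> or
  \<open>n - 1\<close>, is attained; \<open>R\<close> is the complement of the set carrying the
  extremal complete family.\<close>

lemma cross_intersecting_weight_bound:
  assumes n: "n > k + l" and k: "k \<ge> 1" and r: "l \<ge> r" "r \<ge> 1" and c: "c > 0"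
    and \<A>: "\<A> \<subseteq> nsets {1..n} k" and \<B>: "\<B> \<subseteq> nsets {1..n} l"
    and cross: "cross_intersecting \<A> \<B>"
    and lower: "((n - r) choose (l - r)) \<le> card \<B>" and upper: "card \<B> \<le> ((n - 1) choose (l - 1))"
  defines "v \<equiv> real (card \<A>) + c * real (card \<B>)"
    and "w \<equiv> weight n k l c"
  shows "v \<le> max (w r) (w 1)"
    and "v = max (w r) (w 1) \<Longrightarrow>
      \<exists>j\<in>{r, 1}. \<exists>R. R \<subseteq> {1..n} \<and> card R = j \<and> \<A> = hitting n k R \<and> \<B> = containing n l R"
proof -
  define s where "s = n - l"
  define F where "F = compl_family n \<B>"
  define G where "G = shadow k F"
  \<comment> \<open>\<open>n > k + l\<close> enters as \<open>k < s\<close>, as required by the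
    strict secant inequality and by uniqueness in the shadow bound.\<close>
  have ks: "k < s" and sn: "s \<le> n - r" "s \<le> n - 1" and s1: "s \<ge> 1"
    using n k r by (auto simp: s_def)
  have F: "F \<subseteq> nsets {1..n} s"
    unfolding F_def s_def using \<B> by (rule compl_family_subset)
  have FB: "\<B> = compl_family n F"
    unfolding F_def using compl_family_compl_family[OF \<B>] ..
  have cardF: "card F = card \<B>"
    unfolding F_def using \<B> by (rule card_compl_family)
  have finF: "finite F"
    using F finite_imp_finite_nsets finite_subset by blast
  \<comment> \<open>Turns the bounds on \<open>card \<B>\<close> into values of
    \<open>t gchoose s\<close> at \<open>t = n - r\<close> and \<open>t = n - 1\<close>.\<close>
  have cF: "(n - j) choose (l - j) = (n - j) choose s" if "j \<le> l" for j
    using choose_compl[of j l n] that n by (simp add: s_def)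
  have "(n - r) choose s > 0"
    using sn by simp
  then have "real (card F) \<ge> 1"
    using lower cF[of r] r cardF by linarith
  then obtain x where x: "x \<ge> real s" "x gchoose s = real (card F)"
    using gbinomial_surj s1 by blast
  have xr: "real (n - r) \<le> x"
  proof (rule ccontr)
    assume "\<not> ?thesis"
    then have "x gchoose s < real (n - r) gchoose s"
      using x s1 by (intro gbinomial_less) auto
    then show False
      using x lower cF[of r] r cardF by (simp flip: binomial_gbinomial)
  qed
  have x1: "x \<le> real (n - 1)"
  proof (rule ccontr)
    assume "\<not> ?thesis"
    then have "real (n - 1) gchoose s < x gchoose s"
      using sn s1 by (intro gbinomial_less) (auto simp: of_nat_diff)
    then show False
      using x upper cF[of 1] r cardF by (simp flip: binomial_gbinomial)
  qed
  have G: "G \<subseteq> nsets {1..n} k"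
    using F by (auto simp: G_def shadow_def nsets_def)
  have finN: "finite (nsets {1..n} k)"
    by (simp add: finite_imp_finite_nsets)
  have disj: "\<A> \<inter> G = {}"
    unfolding G_def F_def using cross \<A> by (rule compl_family_disjoint_shadow)
  have cardAG: "card (\<A> \<union> G) = card \<A> + card G"
    using disj \<A> G finN by (intro card_Un_disjoint) (auto intro: finite_subset)
  moreover have "card (\<A> \<union> G) \<le> n choose k"
    using card_mono[OF finN, of "\<A> \<union> G"] \<A> G by simp
  ultimately have AG: "real (card \<A>) + real (card G) \<le> real (n choose k)"
    by simp
  have shadow: "x gchoose k \<le> real (card G) \<and> (real (card G) = x gchoose k \<longrightarrow>
      (\<exists>X. finite X \<and> real (card X) = x \<and> F = nsets X s))"
    using shadow_lower_bound[of k s F x] k ks finF F x unfolding G_def by (auto simp: nsets_def)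
  \<comment> \<open>\<open>real (n choose k) + h t\<close> is the bound obtained when the shadow has
    at least \<open>t gchoose k\<close> members; at \<open>t = n - j\<close> it is
    \<open>w j\<close>.\<close>
  define h where "h t = c * (t gchoose s) - (t gchoose k)" for t :: real
  have v: "v \<le> real (n choose k) + h x"
    using AG shadow x by (simp add: v_def h_def cardF)
  have w: "w j = real (n choose k) + h (real (n - j))" if "j \<le> l" for j
    using cF[OF that] by (simp add: w_def weight_def h_def binomial_gbinomial)
  have interior: "h x < max (h (real (n - r))) (h (real (n - 1)))"
    if "x \<noteq> real (n - r)" "x \<noteq> real (n - 1)"
    unfolding h_def using that xr x1 sn k ks c
    by (intro gbinomial_combination_less_max) auto
  have hx: "h x \<le> max (h (real (n - r))) (h (real (n - 1)))"
    using interior by fastforce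
  have max_w: "max (w r) (w 1) = real (n choose k) + max (h (real (n - r))) (h (real (n - 1)))"
    unfolding max_add_distrib_right w[OF r(1)] w[OF order_trans[OF r(2,1)]] ..
  show "v \<le> max (w r) (w 1)"
    using v hx max_w by linarith
  assume eq: "v = max (w r) (w 1)"
  \<comment> \<open>Every inequality in the chain is tight, so \<open>x\<close> cannot lie strictly
    between the end points.\<close>
  then have eq': "v = real (n choose k) + h x" and "\<not> h x < max (h (real (n - r))) (h (real (n - 1)))"
    using v hx max_w by linarith+
  then obtain j where j: "j \<in> {r, 1}" "x = real (n - j)"
    using interior by blast
  have "real (card \<A>) = real (n choose k) - (x gchoose k)"
    using eq' x by (simp add: v_def h_def cardF)
  then have cG: "real (card G) = x gchoose k" and cA: "real (card \<A>) + real (card G) = real (n choose k)"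
    using AG shadow by linarith+
  obtain X where X: "finite X" "card X = n - j" "F = nsets X s"
    using shadow cG unfolding j(2) of_nat_eq_iff by blast
  have sX: "s \<le> card X"
    unfolding X(2) using j(1) sn by blast
  \<comment> \<open>As \<open>s \<le> card X\<close>, each point of \<open>X\<close> lies in some
    member of \<open>F\<close>; the 1-shadow makes this explicit.\<close>
  have "X \<subseteq> {1..n}"
  proof
    fix u assume "u \<in> X"
    then have "{u} \<in> nsets X 1"
      by (auto simp: nsets_def)
    then have "{u} \<in> shadow 1 (nsets X s)"
      unfolding shadow_nsets[OF s1 sX X(1)] .
    then obtain S where "S \<in> nsets X s" "u \<in> S"
      unfolding shadow_def nsets_def by blast
    then have "S \<in> nsets {1..n} s"
      using F X(3) by blast
    with \<open>u \<in> S\<close> show "u \<in> {1..n}"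
      unfolding nsets_def by blast
  qed
  define R where "R = {1..n} - X"
  have "R \<subseteq> {1..n}"
    unfolding R_def by blast
  have XR: "X = {1..n} - R"
    using \<open>X \<subseteq> {1..n}\<close> by (auto simp: R_def)
  have "j \<le> n"
    using j r n by auto
  then have cardR: "card R = j"
    using \<open>X \<subseteq> {1..n}\<close> X by (simp add: R_def card_Diff_subset)
  \<comment> \<open>The count has no slack, so \<open>\<A>\<close> is exactly what the shadow leaves
    over.\<close>
  have "\<A> \<union> G = nsets {1..n} k"
    using \<A> G finN cardAG cA by (intro card_subset_eq) auto
  then have "\<A> = nsets {1..n} k - G"
    using disj by blast
  also have "G = nsets X k"
    unfolding G_def X(3) using ks sX X by (intro shadow_nsets) auto
  finally have "\<A> = hitting n k R"
    unfolding hitting_eq XR .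
  moreover have "\<B> = containing n l R"
    unfolding FB X(3) XR s_def using n \<open>R \<subseteq> {1..n}\<close> by (intro compl_family_nsets) auto
  ultimately show "\<exists>j\<in>{r, 1}. \<exists>R. R \<subseteq> {1..n} \<and> card R = j \<and> \<A> = hitting n k R \<and> \<B> = containing n l R"
    using j(1) cardR \<open>R \<subseteq> {1..n}\<close> by blast
qed

section \<open>The two cases \<open>n = k + l\<close> and \<open>n > k + l\<close>\<close>

theorem theorem1p4:
  fixes n k l r :: nat and c :: real and \<A> \<B> :: "nat set set"
  assumes "n \<ge> k + l" and "k \<ge> 1" and "l \<ge> r" and "r \<ge> 1" and "c > 0"
    and "\<A> \<subseteq> nsets {1..n} k" and "\<B> \<subseteq> nsets {1..n} l"
    and "cross_intersecting \<A> \<B>"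
    and "((n - r) choose (l - r)) \<le> card \<B>" and "card \<B> \<le> ((n - 1) choose (l - 1))"
  defines "M\<^sub>1 \<equiv> real (n choose k) - real ((n - r) choose k) + c * real ((n - r) choose (l - r))"
    and "M\<^sub>2 \<equiv> real ((n - 1) choose (k - 1)) + c * real ((n - 1) choose (l - 1))"
  shows "real (card \<A>) + c * real (card \<B>) \<le> max M\<^sub>1 M\<^sub>2
    \<and> (real (card \<A>) + c * real (card \<B>) = max M\<^sub>1 M\<^sub>2 \<longleftrightarrow>
        (M\<^sub>1 \<ge> M\<^sub>2 \<and> n > k + l \<and>
          pair_isomorphic n (\<A>, \<B>)
            ({A \<in> nsets {1..n} k. {1..r} \<inter> A \<noteq> {}}, {B \<in> nsets {1..n} l. {1..r} \<subseteq> B}))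
      \<or> (M\<^sub>1 \<le> M\<^sub>2 \<and> n > k + l \<and>
          pair_isomorphic n (\<A>, \<B>)
            ({A \<in> nsets {1..n} k. 1 \<in> A}, {B \<in> nsets {1..n} l. 1 \<in> B}))
      \<or> (n = k + l \<and> c < 1 \<and> \<B> \<subseteq> nsets {1..n} l \<and>
          card \<B> = ((n - r) choose (l - r)) \<and> \<A> = nsets {1..n} k - compl_family n \<B>)
      \<or> (n = k + l \<and> c = 1 \<and> \<B> \<subseteq> nsets {1..n} l \<and>
          ((n - r) choose (l - r)) \<le> card \<B> \<and> card \<B> \<le> ((n - 1) choose (l - 1)) \<and>
          \<A> = nsets {1..n} k - compl_family n \<B>)
      \<or> (n = k + l \<and> c > 1 \<and> \<B> \<subseteq> nsets {1..n} l \<and>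
          card \<B> = ((n - 1) choose (l - 1)) \<and> \<A> = nsets {1..n} k - compl_family n \<B>))"
proof -
  define v where "v = real (card \<A>) + c * real (card \<B>)"
  have M: "M\<^sub>1 = weight n k l c r" "M\<^sub>2 = weight n k l c 1"
    unfolding M\<^sub>1_def M\<^sub>2_def using assms(1-4) weight_one[of n k l c] by (simp_all add: weight_def)
  show ?thesis
  proof (cases "n = k + l")
    case True
    \<comment> \<open>Complements of \<open>l\<close>-sets are now \<open>k\<close>-sets, so
      \<open>F\<close> is its own shadow and cross-intersection says just that \<open>\<A>\<close>
      and \<open>F\<close> are disjoint.\<close>
    define F where "F = compl_family n \<B>"
    have F: "F \<subseteq> nsets {1..n} k"
      unfolding F_def using compl_family_subset[OF assms(7)] True by simp
    have cardF: "card F = card \<B>"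
      unfolding F_def using assms(7) by (rule card_compl_family)
    have finN: "finite (nsets {1..n} k)"
      by (simp add: finite_imp_finite_nsets)
    have disj: "\<A> \<inter> F = {}"
      using compl_family_disjoint_shadow[OF assms(8,6)] shadow_self[of F k] F
      unfolding F_def by (auto simp: nsets_def)
    have cardAF: "card (\<A> \<union> F) = card \<A> + card F"
      using disj assms(6) F finN by (intro card_Un_disjoint) (auto intro: finite_subset)
    have sub: "\<A> \<union> F \<subseteq> nsets {1..n} k"
      using assms(6) F by simp
    have le: "card \<A> + card \<B> \<le> n choose k"
      using card_mono[OF finN sub] cardAF cardF by simp
    have iff: "\<A> = nsets {1..n} k - F \<longleftrightarrow> card \<A> + card \<B> = n choose k"
    proof
      assume "card \<A> + card \<B> = n choose k"
      then have "\<A> \<union> F = nsets {1..n} k"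
        using card_subset_eq[OF finN sub] cardAF cardF by simp
      with disj show "\<A> = nsets {1..n} k - F" by blast
    next
      assume "\<A> = nsets {1..n} k - F"
      then have "\<A> \<union> F = nsets {1..n} k"
        using F by blast
      with cardAF cardF show "card \<A> + card \<B> = n choose k" by simp
    qed
    define C b m\<^sub>1 m\<^sub>2 where "C = real (n choose k)" and "b = real (card \<B>)"
      and "m\<^sub>1 = real ((n - r) choose (l - r))" and "m\<^sub>2 = real ((n - 1) choose (l - 1))"
    \<comment> \<open>Since \<open>n - l = k\<close>, the binomials \<open>(n - j) choose k\<close>
      and \<open>(n - j) choose (l - j)\<close> coincide by symmetry.\<close>
    have weight: "weight n k l c j = C + (c - 1) * real ((n - j) choose (l - j))" if "j \<le> l" for j
      using choose_compl[OF that, of n] True by (simp add: weight_def C_def algebra_simps)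
    have M': "M\<^sub>1 = C + (c - 1) * m\<^sub>1" "M\<^sub>2 = C + (c - 1) * m\<^sub>2"
      using M weight[of r] weight[of 1] assms(3,4) by (auto simp: m\<^sub>1_def m\<^sub>2_def)
    have b: "m\<^sub>1 \<le> b" "b \<le> m\<^sub>2"
      using assms(9,10) by (auto simp: m\<^sub>1_def m\<^sub>2_def b_def)
    have v: "v = card \<A> + b + (c - 1) * b"
      by (simp add: v_def b_def algebra_simps)
    have le': "card \<A> + b \<le> C"
      using le by (simp add: b_def C_def flip: of_nat_add)
    have iff': "\<A> = nsets {1..n} k - F \<longleftrightarrow> card \<A> + b = C"
      unfolding iff b_def C_def by (simp flip: of_nat_add)
    have eqs: "card \<B> = ((n - r) choose (l - r)) \<longleftrightarrow> b = m\<^sub>1"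
      "card \<B> = ((n - 1) choose (l - 1)) \<longleftrightarrow> b = m\<^sub>2"
      by (auto simp: m\<^sub>1_def m\<^sub>2_def b_def)
    \<comment> \<open>\<open>v \<le> C + (c - 1) * b\<close>, with equality when \<open>\<A>\<close>
      fills the complement of \<open>F\<close>. This is linear in \<open>b\<close>, so the sign of
      \<open>c - 1\<close> selects the optimal end, and for \<open>c = 1\<close> every admissible
      \<open>b\<close> is optimal.\<close>
    consider "c < 1" | "c = 1" | "c > 1" by linarith
    then have "v \<le> max M\<^sub>1 M\<^sub>2 \<and> (v = max M\<^sub>1 M\<^sub>2 \<longleftrightarrow> card \<A> + b = C \<and>
        (c < 1 \<and> b = m\<^sub>1 \<or> c = 1 \<or> c > 1 \<and> b = m\<^sub>2))"
    proof cases
      case 1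
      then have "(c - 1) * b \<le> (c - 1) * m\<^sub>1" "(c - 1) * m\<^sub>2 \<le> (c - 1) * m\<^sub>1"
        "(c - 1) * b = (c - 1) * m\<^sub>1 \<longleftrightarrow> b = m\<^sub>1"
        using b by (auto simp: mult_le_cancel_left)
      moreover from this have "max M\<^sub>1 M\<^sub>2 = C + (c - 1) * m\<^sub>1"
        unfolding M' by simp
      ultimately show ?thesis
        using 1 le' unfolding v by (smt (verit))
    next
      case 2
      then show ?thesis
        using le' unfolding v M' by auto
    next
      case 3
      then have "(c - 1) * b \<le> (c - 1) * m\<^sub>2" "(c - 1) * m\<^sub>1 \<le> (c - 1) * m\<^sub>2"
        "(c - 1) * b = (c - 1) * m\<^sub>2 \<longleftrightarrow> b = m\<^sub>2"
        using b by (auto simp: mult_le_cancel_left)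
      moreover from this have "max M\<^sub>1 M\<^sub>2 = C + (c - 1) * m\<^sub>2"
        unfolding M' by simp
      ultimately show ?thesis
        using 3 le' unfolding v by (smt (verit))
    qed
    then show ?thesis
      unfolding eqs F_def [symmetric] iff' v_def [symmetric]
      using True assms(7,9,10) by auto
  next
    case False
    then have n: "n > k + l"
      using assms(1) by simp
    note bound = cross_intersecting_weight_bound[OF n assms(2-10), folded v_def M]
    have one: "{A \<in> nsets {1..n} k. 1 \<in> A} = hitting n k {1..1}"
      "{B \<in> nsets {1..n} l. 1 \<in> B} = containing n l {1..1}"
      by auto
    \<comment> \<open>The value depends only on the two cardinalities, which relabelling
      preserves.\<close>
    have attained: "v = weight n k l c j"
      if "pair_isomorphic n (\<A>, \<B>) (hitting n k {1..j}, containing n l {1..j})" "j \<in> {r, 1}" for j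
      using pair_isomorphic_card[OF that(1)] weight_hitting_containing[of "{1..j}" n l k c]
        that(2) n assms(3,4) by (auto simp: v_def)
    have iso: "\<exists>j\<in>{r, 1}. v = weight n k l c j \<and>
        pair_isomorphic n (\<A>, \<B>) (hitting n k {1..j}, containing n l {1..j})"
      if eq: "v = max M\<^sub>1 M\<^sub>2"
    proof -
      obtain j R where R: "j \<in> {r, 1}" "R \<subseteq> {1..n}" "card R = j"
        "\<A> = hitting n k R" "\<B> = containing n l R"
        using bound(2)[OF eq] by blast
      then have "pair_isomorphic n (\<A>, \<B>) (hitting n k {1..j}, containing n l {1..j})"
        using pair_isomorphic_hitting_containing by simp
      with attained R(1) show ?thesis by blast
    qed
    \<comment> \<open>The order of \<open>M\<^sub>1\<close> and \<open>M\<^sub>2\<close> tells which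
      \<open>j\<close> attains the maximum; in a tie both alternatives qualify.\<close>
    have "v = max M\<^sub>1 M\<^sub>2 \<longleftrightarrow>
        M\<^sub>1 \<ge> M\<^sub>2 \<and> pair_isomorphic n (\<A>, \<B>) (hitting n k {1..r}, containing n l {1..r}) \<or>
        M\<^sub>1 \<le> M\<^sub>2 \<and> pair_isomorphic n (\<A>, \<B>) (hitting n k {1..1}, containing n l {1..1})"
      (is "_ \<longleftrightarrow> ?rhs")
    proof
      assume "v = max M\<^sub>1 M\<^sub>2"
      with iso[OF this] show ?rhs
        unfolding M by (auto simp: max_def split: if_splits)
    next
      assume ?rhs
      with attained[of r] attained[of 1] show "v = max M\<^sub>1 M\<^sub>2"
        unfolding M by (auto simp: max_def)
    qed
    with bound(1) n show ?thesis
      unfolding one v_def [symmetric] by simp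
  qed
qed

end
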